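(* For every $n\in\mathbb N=\{1,2,3,\dots\}$ there is a counterexample $G$ of order $5+12n$ to the following conjecture: if $G$ is an essentially $6$-edge-connected $4$-regular graph with a transition system $T$, then $(G,T)$ has no compatible cycle decomposition if and only if $(G,T)$ is the bad loop or the bad $K_5$.
   Context: A transition at a vertex $v$ is a pair of edges (half-edges, if there are loops) incident with $v$; a transition system $T$ of a $4$-regular graph $G$ consists, for each vertex $v$, of a partition of the four edges (half-edges) at $v$ into two transitions. A compatible cycle decomposition of $(G,T)$ is a decomposition of $E(G)$ into circuits (connected $2$-regular subgraphs) such that no circuit contains both members of a transition of $T$. A connected graph is essentially $k$-edge-connected if there is no edge cut with fewer than $k$ edges whose deletion leaves at least two components each containing an edge. The bad loop is a graph with a single vertex (with two loops), with the transition system whose transitions are the pairs of half-edges of the same loop. The bad $K_5$ is the complete graph $K_5$ with the transition system whose transitions are the pairs of adjacent edges that are consecutive on one of two fixed edge-disjoint hamiltonian circuits of $K_5$. *)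

theory Defs
  imports
    "Graph_Theory.Bidirected_Digraph"
    "Graph_Theory.Digraph_Component"
    "Graph_Theory.Kuratowski"
    "HOL-Library.Disjoint_Sets"
begin

text \<open>
  A finite undirected graph with loops and parallel edges allowed is represented by its
  half-edges: the half-edges are the arcs of a digraph, the half-edge \<open>a\<close> is incident with the
  vertex \<open>tail G a\<close>, and the fixed-point-free involution \<open>arev\<close> sends a half-edge to the other
  half of its edge. Hence the edges are the sets \<open>{a, arev a}\<close>, a loop contributes two distinct
  half-edges at its vertex, the half-edges at \<open>v\<close> are \<open>out_arcs G v\<close>, and the degree of \<open>v\<close> is
  \<open>out_degree G v\<close>.
\<close>

locale multigraph = fin_digraph G + bidirected_digraph G arev
  for G :: "('a, 'b) pre_digraph" and arev :: "'b \<Rightarrow> 'b"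

definition edges :: "('a, 'b) pre_digraph \<Rightarrow> ('b \<Rightarrow> 'b) \<Rightarrow> 'b set set" where
  "edges G arev = (\<lambda>a. {a, arev a}) ` arcs G"

definition regular :: "nat \<Rightarrow> ('a, 'b) pre_digraph \<Rightarrow> bool" where
  "regular k G \<longleftrightarrow> (\<forall>v \<in> verts G. out_degree G v = k)"

definition transition_system :: "('a, 'b) pre_digraph \<Rightarrow> ('a \<Rightarrow> 'b set set) \<Rightarrow> bool" where
  "transition_system G T \<longleftrightarrow>
     (\<forall>v \<in> verts G. partition_on (out_arcs G v) (T v) \<and> card (T v) = 2 \<and> (\<forall>t \<in> T v. card t = 2))"

text \<open>
  A subgraph of the undirected graph is a sub-digraph that contains, with a half-edge, the
  other half of the same edge.
\<close>

definition circuit :: "('a, 'b) pre_digraph \<Rightarrow> ('b \<Rightarrow> 'b) \<Rightarrow> ('a, 'b) pre_digraph \<Rightarrow> bool" where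
  "circuit G arev C \<longleftrightarrow>
     subgraph C G \<and> arev ` arcs C \<subseteq> arcs C \<and> connected C \<and> regular 2 C"

definition cycle_decomposition ::
  "('a, 'b) pre_digraph \<Rightarrow> ('b \<Rightarrow> 'b) \<Rightarrow> ('a, 'b) pre_digraph set \<Rightarrow> bool" where
  "cycle_decomposition G arev D \<longleftrightarrow>
     (\<forall>C \<in> D. circuit G arev C) \<and> (\<forall>e \<in> edges G arev. \<exists>!C. C \<in> D \<and> e \<in> edges C arev)"

definition compatible_cycle_decomposition ::
  "('a, 'b) pre_digraph \<Rightarrow> ('b \<Rightarrow> 'b) \<Rightarrow> ('a \<Rightarrow> 'b set set) \<Rightarrow> ('a, 'b) pre_digraph set \<Rightarrow> bool" where
  "compatible_cycle_decomposition G arev T D \<longleftrightarrow>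
     cycle_decomposition G arev D \<and>
     (\<forall>C \<in> D. \<forall>v \<in> verts G. \<forall>t \<in> T v. \<not> t \<subseteq> arcs C)"

definition edge_cut :: "('a, 'b) pre_digraph \<Rightarrow> ('b \<Rightarrow> 'b) \<Rightarrow> 'b set set \<Rightarrow> bool" where
  "edge_cut G arev F \<longleftrightarrow>
     (\<exists>X. X \<noteq> {} \<and> X \<subset> verts G \<and>
          F = {{a, arev a} | a. a \<in> arcs G \<and> tail G a \<in> X \<and> head G a \<notin> X})"

definition delete_edges :: "('a, 'b) pre_digraph \<Rightarrow> 'b set set \<Rightarrow> ('a, 'b) pre_digraph" where
  "delete_edges G F = G\<lparr>arcs := arcs G - \<Union>F\<rparr>"

abbreviation component :: "('a, 'b) pre_digraph \<Rightarrow> ('a, 'b) pre_digraph \<Rightarrow> bool" where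
  "component G \<equiv> pre_digraph.max_subgraph G connected"

definition essentially_edge_connected ::
  "nat \<Rightarrow> ('a, 'b) pre_digraph \<Rightarrow> ('b \<Rightarrow> 'b) \<Rightarrow> bool" where
  "essentially_edge_connected k G arev \<longleftrightarrow>
     connected G \<and>
     \<not> (\<exists>F. edge_cut G arev F \<and> card F < k \<and>
            (\<exists>C1 C2. component (delete_edges G F) C1 \<and> component (delete_edges G F) C2 \<and>
                     C1 \<noteq> C2 \<and> arcs C1 \<noteq> {} \<and> arcs C2 \<noteq> {}))"

definition bad_loop ::
  "('a, 'b) pre_digraph \<Rightarrow> ('b \<Rightarrow> 'b) \<Rightarrow> ('a \<Rightarrow> 'b set set) \<Rightarrow> bool" where
  "bad_loop G arev T \<longleftrightarrow>
     (\<exists>v. verts G = {v} \<and> card (edges G arev) = 2 \<and> T v = edges G arev)"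

text \<open>
  At a vertex \<open>v\<close>, the edges consecutive on a circuit \<open>C\<close> through \<open>v\<close> are given by the two
  half-edges of \<open>C\<close> at \<open>v\<close>. Any two pairs of edge-disjoint hamiltonian circuits of the complete
  graph on five vertices are equivalent under an automorphism, so the existential quantifier
  determines the pair \<open>(G, T)\<close> up to isomorphism.
\<close>

definition bad_K5 ::
  "('a, 'b) pre_digraph \<Rightarrow> ('b \<Rightarrow> 'b) \<Rightarrow> ('a \<Rightarrow> 'b set set) \<Rightarrow> bool" where
  "bad_K5 G arev T \<longleftrightarrow>
     K\<^bsub>5\<^esub> G \<and>
     (\<exists>C1 C2. circuit G arev C1 \<and> verts C1 = verts G \<and>
              circuit G arev C2 \<and> verts C2 = verts G \<and>
              arcs C1 \<inter> arcs C2 = {} \<and>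
              (\<forall>v \<in> verts G. T v = {out_arcs C1 v, out_arcs C2 v}))"

end

(* A compatible cycle decomposition labels every half-edge with its circuit. At a vertex with
   transitions {h, i} and {j, k} the labels satisfy c h ~= c i, c j ~= c k and
   {c h, c i} = {c j, c k}. The counterexample is a chain of n blocks of twelve vertices, closed at
   one end by a tail of five vertices and at the other end by three edges within block 0. The tail
   forces a relation on the labels of the six edges leaving it, every block carries this relation
   over to the six edges leaving the block on the other side, and the three closing edges
   contradict it.

   The graph is the union of two hamiltonian cycles (unrelated to the transitions). A cut with
   fewer than six edges meets each cycle in exactly two edges, so one of its sides is an interval
   of both cycles; the cycles are chosen such that this is only possible for a single vertex or
   the complement of a single vertex. *)

theory Submission
  imports Defs
begin

section \<open>Connectedness and components\<close>

text \<open>The set of vertices reachable from a fixed vertex is closed under adjacency, so it is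
  all of \<open>verts G\<close>. In this form connectedness becomes a question about cuts, which the
  cycles answer below.\<close>

lemma connected_cutI:
  assumes "wf_digraph G" "verts G \<noteq> {}"
    and closed: "\<And>S. S \<subseteq> verts G \<Longrightarrow> S \<noteq> {} \<Longrightarrow>
      (\<And>a. a \<in> arcs G \<Longrightarrow> tail G a \<in> S \<longleftrightarrow> head G a \<in> S) \<Longrightarrow> S = verts G"
  shows "connected G"
  unfolding connected_conv
proof (intro conjI ballI)
  interpret wf_digraph G by fact
  fix u v assume u: "u \<in> verts G" and v: "v \<in> verts G"
  let ?R = "rtrancl_on (verts G) ((arcs_ends G)\<^sup>s)"
  let ?S = "{w. (u, w) \<in> ?R}"
  have S: "?S \<subseteq> verts G"
    by (auto dest: in_rtrancl_on_in_F)
  have step: "(u, y) \<in> ?R" if "(u, x) \<in> ?R" "(x, y) \<in> (arcs_ends G)\<^sup>s" "y \<in> verts G" for x y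
    using that rtrancl_on_into_rtrancl_on by fast
  have "?S = verts G"
  proof (rule closed[OF S])
    show "?S \<noteq> {}"
      using u by (auto intro: rtrancl_on_refl)
    fix a assume a: "a \<in> arcs G"
    then have "(tail G a, head G a) \<in> (arcs_ends G)\<^sup>s" "(head G a, tail G a) \<in> (arcs_ends G)\<^sup>s"
      by (auto simp: symcl_def arcs_ends_def arc_to_ends_def)
    then show "tail G a \<in> ?S \<longleftrightarrow> head G a \<in> ?S"
      using step a by auto
  qed
  then show "(u, v) \<in> ?R" using v by auto
qed fact

lemma connected_cutD:
  assumes "connected G" "u \<in> verts G" "u \<in> S"
    and closed: "\<And>a. a \<in> arcs G \<Longrightarrow> tail G a \<in> S \<longleftrightarrow> head G a \<in> S"
  shows "verts G \<subseteq> S"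
proof
  fix v assume "v \<in> verts G"
  then have "(u, v) \<in> rtrancl_on (verts G) ((arcs_ends G)\<^sup>s)"
    using assms by (simp add: connected_conv)
  then show "v \<in> S"
  proof (induct rule: rtrancl_on_induct)
    case (step y z)
    then show ?case
      using closed by (auto simp: symcl_def arcs_ends_def arc_to_ends_def)
  qed (rule \<open>u \<in> S\<close>)
qed

lemma connected_union:
  assumes "wf_digraph G" "wf_digraph H" "compatible G H" "connected G" "connected H"
    and "verts G \<inter> verts H \<noteq> {}"
  shows "connected (union G H)"
proof (rule connected_cutI)
  show "wf_digraph (union G H)" using assms(1-3)
    by (auto simp: wf_digraph_def compatible_def)
  show "verts (union G H) \<noteq> {}" using assms(6) by auto
  fix S assume S: "S \<subseteq> verts (union G H)" "S \<noteq> {}"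
    and cl: "\<And>a. a \<in> arcs (union G H) \<Longrightarrow> tail (union G H) a \<in> S \<longleftrightarrow> head (union G H) a \<in> S"
  have G: "tail G a \<in> S \<longleftrightarrow> head G a \<in> S" if "a \<in> arcs G" for a
    using cl[of a] that by simp
  have H: "tail H a \<in> S \<longleftrightarrow> head H a \<in> S" if "a \<in> arcs H" for a
    using cl[of a] that assms(3) by (simp add: compatible_def)
  obtain x where x: "x \<in> verts G" "x \<in> verts H" using assms(6) by auto
  have "x \<in> S"
    using S connected_cutD[OF assms(4) _ _ G] connected_cutD[OF assms(5) _ _ H] x by fastforce
  then show "S = verts (union G H)"
    using S connected_cutD[OF assms(4) _ _ G, of x] connected_cutD[OF assms(5) _ _ H, of x] x by auto
qed

text \<open>Maximality: the union of \<open>C\<close> with a connected subgraph \<open>K\<close>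
  that meets it is again connected, hence equal to \<open>C\<close>.\<close>

lemma component_contains_connected:
  assumes C: "component G C" and K: "subgraph K G" "connected K"
    and "verts C \<inter> verts K \<noteq> {}"
  shows "subgraph K C"
proof -
  have sub: "subgraph C G" "connected C"
    using C by (auto simp: pre_digraph.max_subgraph_def)
  then have comp: "compatible C K" and wf: "wf_digraph C" "wf_digraph K" "wf_digraph G"
    using K by (auto simp: subgraph_def compatible_def)
  have con: "connected (union C K)"
    using connected_union comp wf sub K assms by blast
  have wfU: "wf_digraph (union C K)"
    using comp wf by (auto simp: wf_digraph_def compatible_def)
  have 1: "subgraph C (union C K)" "subgraph (union C K) G"
    using sub K wf wfU by (auto simp: subgraph_def compatible_def)
  have "union C K = C"
    using C con 1 by (auto simp: pre_digraph.max_subgraph_def)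
  then have "verts K \<subseteq> verts C" "arcs K \<subseteq> arcs C"
    by (metis Un_upper2 verts_union, metis Un_upper2 arcs_union)
  then show ?thesis
    using comp wf by (auto simp: subgraph_def compatible_def)
qed

lemma components_eqI:
  assumes C: "component G C1" "component G C2" and K: "subgraph K G" "connected K"
    and "verts C1 \<inter> verts K \<noteq> {}" "verts C2 \<inter> verts K \<noteq> {}"
  shows "C1 = C2"
proof -
  have "subgraph K C1" "subgraph K C2"
    using assms component_contains_connected by blast+
  then have *: "verts C1 \<inter> verts C2 \<noteq> {}"
    using assms(5) by (auto simp: subgraph_def)
  have "subgraph C1 G" "connected C1" "subgraph C2 G" "connected C2"
    using C by (auto simp: pre_digraph.max_subgraph_def)
  then have "subgraph C1 C2" "subgraph C2 C1"
    using * C component_contains_connected by blast+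
  then show ?thesis
    by (auto simp: subgraph_def compatible_def pre_digraph.equality)
qed

text \<open>The label of a half-edge is the circuit of the decomposition through its edge; at a vertex
  each of the two circuits through it owns exactly two of the four half-edges.\<close>

lemma compatible_cycle_decomposition_labelling:
  fixes G :: "('a, 'b) pre_digraph" and D :: "('a, 'b) pre_digraph set"
  assumes "multigraph G arev" "compatible_cycle_decomposition G arev T D"
  obtains c :: "'b \<Rightarrow> ('a, 'b) pre_digraph" where
    "\<And>a. a \<in> arcs G \<Longrightarrow> c (arev a) = c a"
    "\<And>v h i j k. v \<in> verts G \<Longrightarrow> out_arcs G v = {h, i, j, k} \<Longrightarrow> distinct [h, i, j, k] \<Longrightarrow>
       T v = {{h, i}, {j, k}} \<Longrightarrow> c h \<noteq> c i \<and> c j \<noteq> c k \<and> {c h, c i} = {c j, c k}"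
proof -
  interpret multigraph G arev by fact
  define c where "c a = (THE C. C \<in> D \<and> {a, arev a} \<in> edges C arev)" for a
  have cd: "cycle_decomposition G arev D"
    and comp: "\<And>C v t. C \<in> D \<Longrightarrow> v \<in> verts G \<Longrightarrow> t \<in> T v \<Longrightarrow> \<not> t \<subseteq> arcs C"
    using assms(2) by (auto simp: compatible_cycle_decomposition_def)
  have circ: "circuit G arev C" if "C \<in> D" for C
    using cd that by (auto simp: cycle_decomposition_def)
  have arcs_C: "{a, arev a} \<in> edges C arev \<longleftrightarrow> a \<in> arcs C" if "C \<in> D" for a C
  proof
    assume "{a, arev a} \<in> edges C arev"
    then obtain b where b: "b \<in> arcs C" "{a, arev a} = {b, arev b}" by (auto simp: edges_def)
    then have "a = b \<or> a = arev b" by auto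
    then show "a \<in> arcs C" using b circ[OF that] by (auto simp: circuit_def)
  qed (auto simp: edges_def)
  have ex1: "\<exists>!C. C \<in> D \<and> {a, arev a} \<in> edges C arev" if "a \<in> arcs G" for a
    using cd that by (auto simp: cycle_decomposition_def edges_def)
  have cD: "c a \<in> D" and ca: "a \<in> arcs (c a)" if "a \<in> arcs G" for a
    using theI'[OF ex1[OF that]] arcs_C by (auto simp: c_def)
  have ceq: "c a = C \<longleftrightarrow> a \<in> arcs C" if "a \<in> arcs G" "C \<in> D" for a C
    using ex1[OF that(1)] cD ca arcs_C that by metis
  have rev: "c (arev a) = c a" if "a \<in> arcs G" for a
    by (simp add: c_def insert_commute)
  {
  fix v h i j k assume v: "v \<in> verts G" and o: "out_arcs G v = {h, i, j, k}"
    and d: "distinct [h, i, j, k]" and T: "T v = {{h, i}, {j, k}}"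
  have A: "{h, i, j, k} \<subseteq> arcs G" "\<And>x. x \<in> {h, i, j, k} \<Longrightarrow> tail G x = v"
    using o by (auto simp: out_arcs_def)
  have hi: "c h \<noteq> c i" using comp[OF cD v, of h "{h,i}"] A T ca by auto
  have jk: "c j \<noteq> c k" using comp[OF cD v, of j "{j,k}"] A T ca by auto
  \<comment> \<open>The circuit \<open>c x\<close> passes through \<open>v\<close> and is 2-regular,
    so exactly two of the four half-edges at \<open>v\<close> lie on it.\<close>
  have two: "card {y \<in> {h, i, j, k}. c y = c x} = 2" if x: "x \<in> {h, i, j, k}" for x
  proof -
    let ?C = "c x"
    have xG: "x \<in> arcs G" using A x by auto
    have C: "subgraph ?C G" "regular 2 ?C"
      using circ[OF cD[OF xG]] by (auto simp: circuit_def)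
    then have "tail ?C = tail G" "arcs ?C \<subseteq> arcs G" "wf_digraph ?C"
      by (auto simp: subgraph_def compatible_def)
    moreover from this have "v \<in> verts ?C"
      using A(2)[OF x] ca[OF xG] wf_digraph.tail_in_verts by fastforce
    ultimately have "card (out_arcs ?C v) = 2"
      using C by (auto simp: regular_def out_degree_def)
    moreover have "out_arcs ?C v = {y \<in> out_arcs G v. y \<in> arcs ?C}"
      using \<open>tail ?C = tail G\<close> \<open>arcs ?C \<subseteq> arcs G\<close> by (auto simp: out_arcs_def)
    moreover have "\<dots> = {y \<in> {h, i, j, k}. c y = c x}"
      unfolding o[symmetric] using ceq cD[OF xG] by (auto simp: out_arcs_def)
    ultimately show ?thesis by simp
  qed
  have cnt: "card {y \<in> {h, i, j, k}. P y} = length (filter P [h, i, j, k])" for P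
    using distinct_card[OF distinct_filter[OF d], of P] by (simp only: set_filter list.set)
  \<comment> \<open>The second half-edge labelled \<open>c h\<close> is not \<open>i\<close>, so it
    is \<open>j\<close> or \<open>k\<close>; likewise for \<open>c i\<close>.\<close>
  have "c h \<in> {c j, c k}" "c i \<in> {c j, c k}"
    using two[of h, unfolded cnt] two[of i, unfolded cnt] hi by (auto split: if_splits)
  then have "c h \<noteq> c i \<and> c j \<noteq> c k \<and> {c h, c i} = {c j, c k}"
    using hi jk by auto
  }
  note main = this
  show thesis
    by (rule that[of c]) (fact rev, fact main)
qed


section \<open>Two hamiltonian cycles\<close>

text \<open>\<open>r\<close> counts the steps of \<open>s\<close> from 0 and drops back to 0 only
  after rank \<open>N - 1\<close>. Every rank is thus reached from 0, so \<open>r\<close> is a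
  bijection and \<open>s\<close> a single cycle through all \<open>N\<close> vertices.\<close>

locale ranked_cycle =
  fixes N :: nat and s r :: "nat \<Rightarrow> nat"
  assumes N_gt_1: "1 < N"
    and s_less: "v < N \<Longrightarrow> s v < N"
    and r_less: "v < N \<Longrightarrow> r v < N"
    and r_0: "r 0 = 0"
    and r_s: "v < N \<Longrightarrow> r (s v) = (if Suc (r v) = N then 0 else Suc (r v))"
begin

lemma r_surj: "k < N \<Longrightarrow> \<exists>v<N. r v = k"
proof (induct k)
  case 0
  then show ?case using r_0 by auto
next
  case (Suc k)
  then obtain v where "v < N" "r v = k" by auto
  then show ?case using Suc.prems s_less r_s by (intro exI[of _ "s v"]) auto
qed

lemma inj_on_r: "inj_on r {..<N}"
proof (rule eq_card_imp_inj_on)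
  have "r ` {..<N} = {..<N}"
    using r_surj r_less by (fastforce simp: image_iff)
  then show "card (r ` {..<N}) = card {..<N}" by simp
qed simp

lemma r_eq_iff: "u < N \<Longrightarrow> v < N \<Longrightarrow> r u = r v \<longleftrightarrow> u = v"
  using inj_on_r by (auto simp: inj_on_def)

lemma inj_on_s: "inj_on s {..<N}"
proof (rule inj_onI, simp)
  fix u v assume u: "u < N" and v: "v < N" and e: "s u = s v"
  have "r u = r v"
    using r_s[OF u] r_s[OF v] e r_less u v by (auto split: if_splits)
  then show "u = v" using u v r_eq_iff by blast
qed

lemma bij_betw_s: "bij_betw s {..<N} {..<N}"
  using inj_on_s s_less endo_inj_surj[of "{..<N}" s] by (auto simp: bij_betw_def)

lemma s_neq: "v < N \<Longrightarrow> s v \<noteq> v"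
  using r_s[of v] N_gt_1 by (cases "s v = v") (auto split: if_splits)

definition p where "p = inv_into {..<N} s"

lemma p_less: "v < N \<Longrightarrow> p v < N"
  using bij_betw_s inv_into_into[of v s "{..<N}"] by (auto simp: p_def bij_betw_def)

lemma s_p [simp]: "v < N \<Longrightarrow> s (p v) = v"
  using bij_betw_s by (auto simp: p_def bij_betw_def intro: f_inv_into_f)

lemma p_s [simp]: "v < N \<Longrightarrow> p (s v) = v"
  using inj_on_s by (auto simp: p_def)

lemma p_neq: "v < N \<Longrightarrow> p v \<noteq> v"
  using s_p s_neq p_less by metis

section \<open>Crossings of a vertex set by one cycle\<close>

definition exits where "exits X = {v. v < N \<and> v \<in> X \<and> s v \<notin> X}"
text \<open>Both kinds of crossing are recorded by the vertex before the step, so entries lie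
  outside \<open>X\<close> and exits inside.\<close>

definition entries where "entries X = {v. v < N \<and> v \<notin> X \<and> s v \<in> X}"

lemma finite_exits [simp]: "finite (exits X)" and finite_entries [simp]: "finite (entries X)"
  by (auto simp: exits_def entries_def)

text \<open>\<open>s\<close> permutes the vertices, so \<open>X\<close> and its preimage have the
  same size. Both contain the vertices that stay in \<open>X\<close>; what remains are the exits and
  the entries, respectively.\<close>

lemma card_exits_eq_entries:
  assumes "X \<subseteq> {..<N}"
  shows "card (exits X) = card (entries X)"
proof -
  let ?A = "{v. v < N \<and> v \<in> X \<and> s v \<in> X}"
  let ?Y = "{v. v < N \<and> s v \<in> X}"
  have "s ` ?Y = X"
    using assms p_less by (force simp: image_iff intro: s_p[symmetric])
  moreover have "inj_on s ?Y"
    using inj_on_s by (rule inj_on_subset) auto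
  ultimately have "card ?Y = card X"
    by (metis card_image)
  moreover have "X = exits X \<union> ?A" "exits X \<inter> ?A = {}"
    using assms by (auto simp: exits_def)
  moreover have "?Y = entries X \<union> ?A" "entries X \<inter> ?A = {}"
    by (auto simp: entries_def)
  moreover have "finite ?A" by simp
  ultimately show ?thesis
    by (metis (no_types, lifting) add_right_cancel card_Un_disjoint finite_exits finite_entries)
qed

text \<open>Walk along the cycle from \<open>z\<close> to \<open>w\<close>; the condition on the
  ranks keeps the walk from wrapping around through 0.\<close>

lemma entry_between:
  assumes "z < N" "w < N" "z \<notin> X" "w \<in> X" "r z \<le> r w"
  shows "\<exists>e \<in> entries X. r z \<le> r e \<and> r e < r w"
  using assms
proof (induct "r w - r z" arbitrary: z)
  case 0
  then show ?case using r_eq_iff by (metis diff_is_0_eq le_antisym)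
next
  case (Suc k)
  then have rz: "r z < r w" by linarith
  then have sz: "r (s z) = Suc (r z)" "s z < N"
    using Suc.prems r_s s_less r_less[of w] by (auto split: if_splits)
  show ?case
  proof (cases "s z \<in> X")
    case True
    then show ?thesis using Suc.prems rz by (intro bexI[of _ z]) (auto simp: entries_def)
  next
    case False
    then obtain e where "e \<in> entries X" "r (s z) \<le> r e" "r e < r w"
      using Suc.hyps(1)[of "s z"] Suc.hyps(2) Suc.prems sz rz by fastforce
    then show ?thesis using sz by (intro bexI[of _ e]) auto
  qed
qed

lemma entries_nonempty:
  assumes "X \<subseteq> {..<N}" "0 \<notin> X" "X \<noteq> {}"
  shows "entries X \<noteq> {}"
proof -
  obtain w where "w \<in> X" "w < N" using assms by auto
  then show ?thesis
    using entry_between[of 0 w X] assms N_gt_1 r_0 by auto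
qed

lemma exits_Diff:
  assumes "X \<subseteq> {..<N}" shows "exits ({..<N} - X) = entries X"
  using assms s_less by (auto simp: exits_def entries_def)

text \<open>If 0 lies in \<open>X\<close>, pass to the complement, whose entries are the exits of
  \<open>X\<close>.\<close>

lemma exits_nonempty:
  assumes "X \<subset> {..<N}" "X \<noteq> {}"
  shows "exits X \<noteq> {}"
proof (cases "0 \<in> X")
  case False
  then have "card (exits X) \<noteq> 0"
    using card_exits_eq_entries entries_nonempty[of X] assms by auto
  then show ?thesis by auto
next
  case True
  let ?Y = "{..<N} - X"
  have "entries ?Y \<noteq> {}" using entries_nonempty[of ?Y] True assms by auto
  moreover have "exits ({..<N} - ?Y) = entries ?Y" by (rule exits_Diff) auto
  moreover have "{..<N} - ?Y = X" using assms by auto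
  ultimately show ?thesis by simp
qed

text \<open>A vertex \<open>z\<close> outside \<open>X\<close> would give two entries: one between 0
  and \<open>u\<close>, another between \<open>z\<close> and \<open>w\<close>.\<close>

lemma convex_if_one_entry:
  assumes "card (entries X) \<le> 1" "X \<subseteq> {..<N}" "0 \<notin> X"
    and "u \<in> X" "w \<in> X" "z < N" "r u \<le> r z" "r z \<le> r w"
  shows "z \<in> X"
proof (rule ccontr)
  assume z: "z \<notin> X"
  have "u < N" "w < N" using assms by auto
  then obtain e where e: "e \<in> entries X" "r z \<le> r e"
    using entry_between[of z w X] assms z by auto
  obtain f where f: "f \<in> entries X" "r f < r u"
    using entry_between[of 0 u X] \<open>u < N\<close> assms r_0 by auto
  have "e = f"
    using assms(1) e f card_le_Suc0_iff_eq[OF finite_entries, of X] by auto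
  then show False using e f assms by simp
qed

end

section \<open>The 4-regular graph carried by two cycles\<close>

definition half :: "nat \<Rightarrow> nat \<Rightarrow> nat" where "half v k = 4 * v + k"

lemma half_div [simp]: "k < 4 \<Longrightarrow> half v k div 4 = v"
  and half_mod [simp]: "k < 4 \<Longrightarrow> half v k mod 4 = k"
  by (auto simp: half_def)

lemma half_eq_iff [simp]: "j < 4 \<Longrightarrow> k < 4 \<Longrightarrow> half u j = half v k \<longleftrightarrow> u = v \<and> j = k"
  by (metis half_div half_mod)

lemma half_less_iff [simp]: "k < 4 \<Longrightarrow> half v k < 4 * N \<longleftrightarrow> v < N"
  by (auto simp: half_def)

lemma half_cases:
  obtains v where "a = half v 0" | v where "a = half v 1"
  | v where "a = half v 2" | v where "a = half v 3"
proof -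
  have "a = half (a div 4) (a mod 4)" by (simp add: half_def)
  moreover have "a mod 4 = 0 \<or> a mod 4 = 1 \<or> a mod 4 = 2 \<or> a mod 4 = 3" by presburger
  ultimately show ?thesis using that by metis
qed

text \<open>The half-edges \<open>half v k\<close> at \<open>v\<close> are, for \<open>k = 0, 1, 2, 3\<close>: leaving \<open>v\<close> and entering \<open>v\<close>
  on the first cycle, leaving \<open>v\<close> and entering \<open>v\<close> on the second cycle. The number
  \<open>\<tau> v \<in> {1, 2, 3}\<close> names the half-edge that forms a transition with \<open>half v 0\<close>.\<close>

locale two_cycles = c1: ranked_cycle N s1 r1 + c2: ranked_cycle N s2 r2
  for N s1 r1 s2 r2 +
  fixes \<tau> :: "nat \<Rightarrow> nat"
  assumes \<tau>: "\<tau> v \<in> {1, 2, 3}"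
    and common_convex: "X \<subseteq> {..<N} \<Longrightarrow> 0 \<notin> X \<Longrightarrow>
      (\<And>u w z. u \<in> X \<Longrightarrow> w \<in> X \<Longrightarrow> z < N \<Longrightarrow> r1 u \<le> r1 z \<Longrightarrow> r1 z \<le> r1 w \<Longrightarrow> z \<in> X) \<Longrightarrow>
      (\<And>u w z. u \<in> X \<Longrightarrow> w \<in> X \<Longrightarrow> z < N \<Longrightarrow> r2 u \<le> r2 z \<Longrightarrow> r2 z \<le> r2 w \<Longrightarrow> z \<in> X) \<Longrightarrow>
      card X \<le> 1 \<or> X = {0<..<N}"
begin

text \<open>Beyond the arcs the function is the identity, because \<open>bidirected_digraph\<close>
  asks that it moves exactly the arcs.\<close>

definition arev :: "nat \<Rightarrow> nat" where
  "arev a = (if a < 4 * N then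
     if a mod 4 = 0 then half (s1 (a div 4)) 1
     else if a mod 4 = 1 then half (c1.p (a div 4)) 0
     else if a mod 4 = 2 then half (s2 (a div 4)) 3
     else half (c2.p (a div 4)) 2 else a)"

definition G :: "(nat, nat) pre_digraph" where
  "G = \<lparr>verts = {..<N}, arcs = {..<4 * N}, tail = (\<lambda>a. a div 4), head = (\<lambda>a. arev a div 4)\<rparr>"

definition T :: "nat \<Rightarrow> nat set set" where
  "T v = (if \<tau> v = 1 then {{half v 0, half v 1}, {half v 2, half v 3}}
     else if \<tau> v = 2 then {{half v 0, half v 2}, {half v 1, half v 3}}
     else {{half v 0, half v 3}, {half v 1, half v 2}})"

lemma G_simps [simp]:
  "verts G = {..<N}" "arcs G = {..<4 * N}" "tail G a = a div 4" "head G a = arev a div 4"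
  by (simp_all add: G_def)

lemma arev_half [simp]:
  "v < N \<Longrightarrow> arev (half v 0) = half (s1 v) 1"
  "v < N \<Longrightarrow> arev (half v (Suc 0)) = half (c1.p v) 0"
  "v < N \<Longrightarrow> arev (half v 2) = half (s2 v) 3"
  "v < N \<Longrightarrow> arev (half v 3) = half (c2.p v) 2"
  by (simp_all add: arev_def)

lemma arev_less: "a < 4 * N \<Longrightarrow> arev a < 4 * N"
  by (cases a rule: half_cases)
    (auto simp: c1.s_less c2.s_less c1.p_less c2.p_less)

lemma arev_div_less: "a < 4 * N \<Longrightarrow> arev a div 4 < N"
  using arev_less[of a] by linarith

lemma arev_arev: "arev (arev a) = a"
  by (cases "a < 4 * N"; cases a rule: half_cases)
    (auto simp: c1.s_less c2.s_less c1.p_less c2.p_less, auto simp: arev_def)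

lemma arev_div_neq: "a < 4 * N \<Longrightarrow> arev a div 4 \<noteq> a div 4"
  by (cases a rule: half_cases) (auto simp: c1.s_neq c2.s_neq c1.p_neq c2.p_neq)

sublocale multigraph G arev
proof
  show "a \<in> arcs G \<longleftrightarrow> arev a \<noteq> a" for a
    using arev_div_neq[of a] by (auto simp: arev_def)
  show "head G a \<in> verts G" if "a \<in> arcs G" for a
    using arev_less[of a] that by auto
qed (auto simp: arev_arev)

lemma out_arcs_G: "v < N \<Longrightarrow> out_arcs G v = {half v 0, half v 1, half v 2, half v 3}"
proof -
  assume v: "v < N"
  have "a \<in> {half v 0, half v 1, half v 2, half v 3}" if "a div 4 = v" for a
    using that by (cases a rule: half_cases) auto
  then show ?thesis using v by (auto simp: out_arcs_def)
qed

lemma regular_G: "regular 4 G"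
  by (auto simp: regular_def out_degree_def out_arcs_G)

lemma transition_system_T: "transition_system G T"
  unfolding transition_system_def
proof (intro ballI conjI)
  fix v assume "v \<in> verts G"
  then have v: "v < N" by simp
  show "partition_on (out_arcs G v) (T v)"
    by (auto simp: partition_on_def out_arcs_G[OF v] T_def disjoint_def)
  show "card (T v) = 2"
    by (auto simp: T_def card_insert_if doubleton_eq_iff)
  fix t assume "t \<in> T v"
  then show "card t = 2" by (auto simp: T_def split: if_splits)
qed

text \<open>The first cycle without \<open>v\<close> is a path through all other vertices. If
  \<open>S\<close> and its complement in \<open>H\<close> were both nonempty, the cycle would exit
  each of them, but the only possible exit is the predecessor of \<open>v\<close>, which cannot lie
  in both.\<close>

lemma connected_del_vertex:
  assumes H: "wf_digraph H" "verts H = {..<N} - {v}" "tail H = tail G" "head H = head G"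
    and A: "{half u 0 |u. u < N \<and> u \<noteq> v \<and> s1 u \<noteq> v} \<subseteq> arcs H" and v: "v < N"
  shows "connected H"
proof (rule connected_cutI)
  show "wf_digraph H" by fact
  show "verts H \<noteq> {}"
    using H c1.N_gt_1 c1.s_less[OF v] c1.s_neq[OF v] by auto
  fix S assume S: "S \<subseteq> verts H" "S \<noteq> {}"
    and cl: "\<And>a. a \<in> arcs H \<Longrightarrow> tail H a \<in> S \<longleftrightarrow> head H a \<in> S"
  have step: "u \<in> S \<longleftrightarrow> s1 u \<in> S" if "u < N" "u \<noteq> v" "s1 u \<noteq> v" for u
    using cl[of "half u 0"] A that H by auto
  have ex: "u = c1.p v" if "Y = S \<or> Y = verts H - S" "u \<in> c1.exits Y" for u Y
  proof -
    have "s1 u = v"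
      using that S step[of u] H c1.s_less[of u] by (auto simp: c1.exits_def)
    then show ?thesis using that by (auto simp: c1.exits_def)
  qed
  show "S = verts H"
  proof (rule ccontr)
    assume n: "S \<noteq> verts H"
    have "S \<subset> {..<N}" "verts H - S \<subset> {..<N}" "verts H - S \<noteq> {}"
      using S H n v by auto
    then have "c1.exits S \<noteq> {}" "c1.exits (verts H - S) \<noteq> {}"
      using c1.exits_nonempty S by auto
    then have "c1.p v \<in> c1.exits S" "c1.p v \<in> c1.exits (verts H - S)"
      using ex by blast+
    then show False by (auto simp: c1.exits_def)
  qed
qed

lemma connected_G: "connected G"
proof (rule connected_cutI)
  show "wf_digraph G" by unfold_locales
  show "verts G \<noteq> {}" using c1.N_gt_1 by auto
  fix S assume S: "S \<subseteq> verts G" "S \<noteq> {}"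
    and cl: "\<And>a. a \<in> arcs G \<Longrightarrow> tail G a \<in> S \<longleftrightarrow> head G a \<in> S"
  have "c1.exits S = {}"
    using cl[of "half v 0" for v] by (auto simp: c1.exits_def)
  then show "S = verts G" using c1.exits_nonempty[of S] S by auto
qed

section \<open>Edge cuts with fewer than six edges\<close>

definition cut :: "nat set \<Rightarrow> nat set set" where
  "cut X = {{a, arev a} | a. a \<in> arcs G \<and> tail G a \<in> X \<and> head G a \<notin> X}"

lemma cut_compl: 
  assumes "X \<subseteq> {..<N}"
  shows "cut ({..<N} - X) = cut X"
proof -
  have *: "cut (verts G - X) \<subseteq> cut X" for X
  proof
    fix e assume "e \<in> cut (verts G - X)"
    then obtain a where a: "e = {a, arev a}" "a \<in> arcs G" "tail G a \<in> verts G - X"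
      "head G a \<notin> verts G - X"
      by (auto simp only: cut_def mem_Collect_eq)
    then have "e = {arev a, arev (arev a)}" "arev a \<in> arcs G" "tail G (arev a) \<in> X"
      "head G (arev a) \<notin> X"
      using head_in_verts[of a] by (auto simp: insert_commute arev_arev arev_less)
    then show "e \<in> cut X" unfolding cut_def by blast
  qed
  have "{..<N} - ({..<N} - X) = X" using assms by auto
  then show ?thesis using *[of X] *[of "{..<N} - X"] by auto
qed

text \<open>Every exit and every entry of either cycle gives a half-edge leaving \<open>X\<close>;
  the four kinds occupy different positions \<open>0, 1, 2, 3\<close>, and each cut edge has only
  one half-edge with its tail in \<open>X\<close>.\<close>

lemma card_cut_ge:
  assumes X: "X \<subseteq> {..<N}"
  shows "2 * card (c1.entries X) + 2 * card (c2.entries X) \<le> card (cut X)"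
proof -
  let ?A = "(\<lambda>v. half v 0) ` c1.exits X" and ?B = "(\<lambda>v. half (s1 v) 1) ` c1.entries X"
  let ?C = "(\<lambda>v. half v 2) ` c2.exits X" and ?D = "(\<lambda>v. half (s2 v) 3) ` c2.entries X"
  let ?F = "{a. a < 4 * N \<and> a div 4 \<in> X \<and> arev a div 4 \<notin> X}"
  have inj: "inj_on s1 (c1.entries X)" "inj_on s2 (c2.entries X)"
    by (rule inj_on_subset[OF c1.inj_on_s], auto simp: c1.entries_def)
      (rule inj_on_subset[OF c2.inj_on_s], auto simp: c2.entries_def)
  have "?A \<inter> ?B = {}" "(?A \<union> ?B) \<inter> ?C = {}" "(?A \<union> ?B \<union> ?C) \<inter> ?D = {}"
    by auto
  then have 1: "card (?A \<union> ?B \<union> ?C \<union> ?D) = card ?A + card ?B + card ?C + card ?D"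
    by (simp add: card_Un_disjoint)
  have 2: "card ?A = card (c1.exits X)" "card ?B = card (c1.entries X)"
    "card ?C = card (c2.exits X)" "card ?D = card (c2.entries X)"
    using inj by (simp_all add: card_image inj_on_def)
  have "?A \<union> ?B \<union> ?C \<union> ?D \<subseteq> ?F"
    by (auto simp: c1.exits_def c1.entries_def c2.exits_def c2.entries_def c1.s_less c2.s_less)
  then have 3: "card (?A \<union> ?B \<union> ?C \<union> ?D) \<le> card ?F"
    by (intro card_mono) auto
  have 4: "card ?F = card (cut X)"
  proof -
    have "cut X = (\<lambda>a. {a, arev a}) ` ?F" by (auto simp: cut_def)
    moreover have "inj_on (\<lambda>a. {a, arev a}) ?F"
      by (rule inj_onI) (auto simp: doubleton_eq_iff)
    ultimately show ?thesis by (simp add: card_image)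
  qed
  show ?thesis
    using 1 2 3 4 c1.card_exits_eq_entries[OF X] c2.card_exits_eq_entries[OF X] by linarith
qed

text \<open>Every cycle crosses a cut at least twice and an even number of times. A cut with fewer than
  six edges is thus crossed exactly twice by both cycles, so its side without \<open>0\<close> is convex in both
  orders.\<close>

lemma small_cut_trivial:
  assumes X: "X \<subseteq> {..<N}" "X \<noteq> {}" "0 \<notin> X" and c: "card (cut X) < 6"
  shows "\<exists>v<N. X = {v} \<or> X = {..<N} - {v}"
proof -
  have "card (c1.entries X) \<noteq> 0" "card (c2.entries X) \<noteq> 0"
    using c1.entries_nonempty c2.entries_nonempty X by auto
  then have e: "card (c1.entries X) \<le> 1" "card (c2.entries X) \<le> 1"
    using card_cut_ge[OF X(1)] c by linarith+
  have "card X \<le> 1 \<or> X = {0<..<N}"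
    by (rule common_convex[OF X(1,3)])
      (fact c1.convex_if_one_entry[OF e(1) X(1,3)], fact c2.convex_if_one_entry[OF e(2) X(1,3)])
  then show ?thesis
  proof
    assume "card X \<le> 1"
    moreover have "card X \<noteq> 0" using X finite_subset[OF X(1)] by auto
    ultimately obtain v where "X = {v}" by (metis One_nat_def card_1_singletonE le_SucE le_zero_eq)
    then show ?thesis using X by auto
  next
    assume "X = {0<..<N}"
    then have "X = {..<N} - {0}" by auto
    then show ?thesis using c1.N_gt_1 by (intro exI[of _ 0]) auto
  qed
qed

text \<open>Without loops, \<open>v\<close> becomes isolated, so a component with an arc contains
  another vertex. All other vertices are connected by what is left of the first cycle.\<close>

lemma cut_vertex_components:
  assumes v: "v < N" and C: "component (delete_edges G (cut {v})) C1"
    "component (delete_edges G (cut {v})) C2" "arcs C1 \<noteq> {}" "arcs C2 \<noteq> {}"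
  shows "C1 = C2"
proof -
  let ?H = "delete_edges G (cut {v})"
  let ?A = "{a. a < 4 * N \<and> a div 4 \<noteq> v \<and> arev a div 4 \<noteq> v}"
  let ?K = "\<lparr>verts = {..<N} - {v}, arcs = ?A, tail = tail G, head = head G\<rparr>"
  have arcs_H: "arcs ?H = ?A"
  proof -
    have "\<Union> (cut {v}) = {a. a < 4 * N \<and> (a div 4 = v \<or> arev a div 4 = v)}"
    proof (intro equalityI subsetI)
      fix b assume "b \<in> \<Union> (cut {v})"
      then show "b \<in> {a. a < 4 * N \<and> (a div 4 = v \<or> arev a div 4 = v)}"
        by (auto simp: cut_def arev_arev arev_less)
    next
      fix b assume b: "b \<in> {a. a < 4 * N \<and> (a div 4 = v \<or> arev a div 4 = v)}"
      then consider "b < 4 * N" "b div 4 = v" | "b < 4 * N" "arev b div 4 = v" by auto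
      then show "b \<in> \<Union> (cut {v})"
      proof cases
        case 1
        then have "{b, arev b} \<in> cut {v}"
          using arev_div_neq[of b] unfolding cut_def by auto
        then show ?thesis by blast
      next
        case 2
        then have "{arev b, arev (arev b)} \<in> cut {v}"
          using arev_div_neq[of b] arev_less[of b] unfolding cut_def
          by (auto simp: arev_arev intro!: exI[of _ "arev b"])
        then show ?thesis by (auto simp: arev_arev)
      qed
    qed
    then show ?thesis by (auto simp: delete_edges_def)
  qed
  have vH: "verts ?H = {..<N}" and th: "tail ?H = tail G" "head ?H = head G"
    by (simp_all add: delete_edges_def)
  have wfK: "wf_digraph ?K"
    by (auto simp: wf_digraph_def arev_div_less)
  have wfH: "wf_digraph ?H"
    unfolding wf_digraph_def arcs_H th vH by (auto simp: arev_div_less)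
  have K: "connected ?K"
    by (rule connected_del_vertex[OF wfK _ _ _ _ v]) auto
  have subK: "subgraph ?K ?H"
    unfolding subgraph_def compatible_def using wfK wfH arcs_H vH th by auto
  have meet: "verts C \<inter> verts ?K \<noteq> {}" if C: "component ?H C" "arcs C \<noteq> {}" for C
  proof -
    have sub: "subgraph C ?H"
      using C by (auto simp: pre_digraph.max_subgraph_def)
    obtain a where a: "a \<in> arcs C" using C by auto
    have "tail C = tail G" "wf_digraph C" "arcs C \<subseteq> ?A"
      using sub th(1) arcs_H by (auto simp: subgraph_def compatible_def)
    then have "a div 4 \<in> verts C" "a \<in> ?A"
      using a wf_digraph.tail_in_verts[of C a] by auto
    then show ?thesis by auto
  qed
  show ?thesis
    by (rule components_eqI[OF C(1,2) subK K meet[OF C(1,3)] meet[OF C(2,4)]])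
qed

lemma essentially_6_edge_connected: "essentially_edge_connected 6 G arev"
  unfolding essentially_edge_connected_def
proof (intro conjI notI connected_G)
  assume "\<exists>F. edge_cut G arev F \<and> card F < 6 \<and>
    (\<exists>C1 C2. component (delete_edges G F) C1 \<and> component (delete_edges G F) C2 \<and>
       C1 \<noteq> C2 \<and> arcs C1 \<noteq> {} \<and> arcs C2 \<noteq> {})"
  then obtain F C1 C2 where F: "edge_cut G arev F" "card F < 6"
    and C: "component (delete_edges G F) C1" "component (delete_edges G F) C2"
       "C1 \<noteq> C2" "arcs C1 \<noteq> {}" "arcs C2 \<noteq> {}"
    by blast
  obtain X where X: "X \<noteq> {}" "X \<subset> {..<N}" "F = cut X"
    using F(1) unfolding edge_cut_def cut_def[symmetric] G_simps(1) by (elim exE conjE) (rule that)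
  \<comment> \<open>Both sides define the same cut, so the side avoiding 0 can be taken, as
    \<open>small_cut_trivial\<close> requires.\<close>
  obtain Y where Y: "Y \<subseteq> {..<N}" "Y \<noteq> {}" "0 \<notin> Y" "F = cut Y"
  proof (cases "0 \<in> X")
    case True
    then show ?thesis using X cut_compl[of X] that[of "{..<N} - X"] by auto
  next
    case False
    then show ?thesis using X that[of X] by auto
  qed
  then obtain v where "v < N" "Y = {v} \<or> Y = {..<N} - {v}"
    using small_cut_trivial F by blast
  then have "v < N" "F = cut {v}" using Y cut_compl[of "{v}"] by auto
  then show False using cut_vertex_components C by blast
qed

lemma labelling:
  assumes "compatible_cycle_decomposition G arev T D"
  obtains c :: "nat \<Rightarrow> (nat, nat) pre_digraph" where
    "\<And>v. v < N \<Longrightarrow> c (half (s1 v) 1) = c (half v 0)"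
    "\<And>v. v < N \<Longrightarrow> c (half (s2 v) 3) = c (half v 2)"
    "\<And>v h i j k. v < N \<Longrightarrow> T v = {{h, i}, {j, k}} \<Longrightarrow> {h, i, j, k} = {half v 0, half v 1, half v 2, half v 3} 
      \<Longrightarrow> distinct [h, i, j, k] \<Longrightarrow> c h \<noteq> c i \<and> c j \<noteq> c k \<and> {c h, c i} = {c j, c k}"
proof -
  obtain c :: "nat \<Rightarrow> (nat, nat) pre_digraph" where c: "\<And>a. a \<in> arcs G \<Longrightarrow> c (arev a) = c a"
    "\<And>v h i j k. v \<in> verts G \<Longrightarrow> out_arcs G v = {h, i, j, k} \<Longrightarrow> distinct [h, i, j, k] \<Longrightarrow>
       T v = {{h, i}, {j, k}} \<Longrightarrow> c h \<noteq> c i \<and> c j \<noteq> c k \<and> {c h, c i} = {c j, c k}"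
    by (rule compatible_cycle_decomposition_labelling[OF multigraph_axioms assms]) (rule that)
  show thesis
  proof (rule that[of c])
    show "c (half (s1 v) 1) = c (half v 0)" "c (half (s2 v) 3) = c (half v 2)" if "v < N" for v
      using c(1)[of "half v 0"] c(1)[of "half v 2"] that by auto
    show "c h \<noteq> c i \<and> c j \<noteq> c k \<and> {c h, c i} = {c j, c k}"
      if "v < N" "T v = {{h, i}, {j, k}}" "{h, i, j, k} = {half v 0, half v 1, half v 2, half v 3}"
        "distinct [h, i, j, k]" for v h i j k
      by (rule c(2)[of v]) (use that out_arcs_G in auto)
  qed
qed

end


section \<open>Labels that contradict a compatible decomposition\<close>

text \<open>The condition on the circuits through the half-edges of a vertex whose transitions carry the
  labels \<open>a, b\<close> and \<open>c, d\<close>.\<close>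

definition swap :: "'a \<Rightarrow> 'a \<Rightarrow> 'a \<Rightarrow> 'a \<Rightarrow> bool" where
  "swap a b c d \<longleftrightarrow> a \<noteq> b \<and> (a = c \<and> b = d \<or> a = d \<and> b = c)"

text \<open>The relation that a compatible decomposition of everything beyond an interface forces on the
  labels of the six edges of the interface: \<open>M\<close> and \<open>M'\<close> are the labels of two pairs of edges,
  \<open>x\<close> and \<open>y\<close> those of the other two edges. Blocks propagate it downwards.\<close>

definition linked :: "'a set \<Rightarrow> 'a set \<Rightarrow> 'a \<Rightarrow> 'a \<Rightarrow> bool" where
  "linked M M' x y \<longleftrightarrow> x \<noteq> y \<and> (\<exists>e. M = {x, e} \<and> M' = {y, e}) \<or> x = y \<and> M = M' \<and> x \<notin> M"

text \<open>Free of sets and of the quantifier over \<open>e\<close>, so that the next two lemmas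
  become finite case distinctions on equalities.\<close>

lemma linked_pairs:
  assumes "a \<noteq> b" "c \<noteq> d"
  shows "linked {a, b} {c, d} x y \<longleftrightarrow>
    x \<noteq> y \<and> (x = a \<and> (y = c \<and> b = d \<or> y = d \<and> b = c) \<or> x = b \<and> (y = c \<and> a = d \<or> y = d \<and> a = c))
    \<or> x = y \<and> (a = c \<and> b = d \<or> a = d \<and> b = c) \<and> x \<noteq> a \<and> x \<noteq> b"
  using assms unfolding linked_def doubleton_eq_iff by auto

text \<open>The letters \<open>a, p, b, q\<close> with index \<open>t\<close> stand for the labels
  of \<open>half v 0, 1, 2, 3\<close> at vertex \<open>t\<close>. On an inner edge the outgoing name
  \<open>a\<close> or \<open>b\<close> is used for both halves, so \<open>p\<close> and
  \<open>q\<close> occur only at the interface.\<close>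

lemma linked_tail:
  assumes "swap p0 q0 a0 b0" "swap a0 b4 a1 b1" "swap a2 b0 a1 b2" "swap a3 a2 b3 b1"
    "swap a4 q4 a3 b4"
  shows "linked {p0, q0} {q4, a4} b2 b3"
proof -
  have "p0 \<noteq> q0" "q4 \<noteq> a4" using assms by (auto simp: swap_def)
  then show ?thesis using assms by (simp add: linked_pairs swap_def) metis
qed

text \<open>The last three hypotheses concern the side of the next block or the tail, the conclusion
  the opposite side. The proof splits over the two pairings at each vertex and the two forms of
  \<open>linked\<close>.\<close>

lemma linked_block:
  assumes "swap p0 q0 a0 b0" "swap a1 a0 b1 q1" "swap a1 b11 a2 b2" "swap a3 b7 a2 b3"
    "swap a4 a3 b4 q4" "swap a5 a4 b5 b9" "swap a6 b10 a5 b6" "swap p7 b2 a7 b7"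
    "swap a8 a7 b8 b3" "swap a8 b6 a9 b9" "swap a10 b0 a9 b10" "swap a11 q11 a10 b11"
    "linked {a6, b5} {b8, p7} q1 q4" "a6 \<noteq> b5" "b8 \<noteq> p7"
  shows "linked {p0, q0} {q11, a11} b1 b4"
proof -
  have "p0 \<noteq> q0" "q11 \<noteq> a11" using assms by (auto simp: swap_def)
  then show ?thesis using assms by (auto simp add: linked_pairs swap_def)
qed


section \<open>The graph\<close>

text \<open>There are \<open>n\<close> blocks of twelve vertices \<open>vx b 0, \<dots>, vx b 11\<close> (\<open>b < n\<close>) and a tail of five
  vertices \<open>vx n 0, \<dots>, vx n 4\<close>. The first cycle runs through \<open>0, 1, 2, 3, 4, 5, 6\<close> of
  the blocks upwards, through \<open>0, 1, 2, 3, 4\<close> of the tail, and through \<open>7, 8, 9, 10, 11\<close> of the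
  blocks downwards. The second cycle runs through \<open>0, 10, 6, 9, 5\<close> of the blocks upwards, through
  \<open>0, 2\<close> of the tail, through \<open>1\<close> of the blocks downwards, through \<open>11, 2, 7, 3, 8\<close> of the blocks
  upwards, through \<open>4, 1, 3\<close> of the tail, and through \<open>4\<close> of the blocks downwards.
  The functions \<open>rank1\<close> and \<open>rank2\<close> give the positions on these cycles.\<close>

definition vx :: "nat \<Rightarrow> nat \<Rightarrow> nat" where "vx b t = 12 * b + t"

definition next1 :: "nat \<Rightarrow> nat \<Rightarrow> nat \<Rightarrow> nat" where
  "next1 n b t =
     (if b < n then
        if t = 6 then vx (b + 1) 0
        else if t = 11 then if b = 0 then vx 0 0 else vx (b - 1) 7
        else vx b (t + 1)
      else if t = 4 then vx (n - 1) 7 else vx n (t + 1))"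

definition rank1 :: "nat \<Rightarrow> nat \<Rightarrow> nat \<Rightarrow> nat" where
  "rank1 n b t = (if t < 7 then 7 * b + t else 12 * n + t - (5 * b + 7))"

text \<open>The zeros at positions \<open>1, 4, 5, 8\<close> of the first list and
  \<open>2, 3\<close> of the second are placeholders: the branches before the lists treat these
  vertices.\<close>

definition next2 :: "nat \<Rightarrow> nat \<Rightarrow> nat \<Rightarrow> nat" where
  "next2 n b t =
     (if b < n then
        if t = 5 then vx (b + 1) 0
        else if t = 8 then if b + 1 < n then vx (b + 1) 11 else vx n 4
        else if t = 1 then if b = 0 then vx 0 11 else vx (b - 1) 1
        else if t = 4 then if b = 0 then vx 0 0 else vx (b - 1) 4
        else vx b ([10, 0, 7, 8, 0, 0, 9, 3, 0, 5, 6, 2] ! t)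
      else if t = 2 then vx (n - 1) 1 else if t = 3 then vx (n - 1) 4
      else vx n ([2, 3, 0, 0, 1] ! t))"

text \<open>The upward passes start at ranks \<open>0\<close> and \<open>6 * n + 2\<close>, the
  downward passes at \<open>5 * n + 2\<close> and \<open>11 * n + 5\<close>; the tail fills the
  gaps.\<close>

definition rank2 :: "nat \<Rightarrow> nat \<Rightarrow> nat \<Rightarrow> nat" where
  "rank2 n b t =
     (if b < n then
        if t = 1 then 6 * n + 1 - b else if t = 4 then 12 * n + 4 - b
        else 5 * b + (if t \<in> {2, 3, 7, 8, 11} then 6 * n + 2 else 0)
          + [0, 0, 1, 3, 0, 4, 2, 2, 4, 3, 1, 0] ! t
      else [5 * n, 11 * n + 3, 5 * n + 1, 11 * n + 4, 11 * n + 2] ! t)"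

text \<open>The table of transitions, used as \<open>\<tau>\<close>; its entries produce the
  \<open>swap\<close> hypotheses of \<open>linked_tail\<close> and \<open>linked_block\<close>. The
  default \<open>1\<close> keeps the value in range for numbers that are not vertices.\<close>

definition mate :: "nat \<Rightarrow> nat \<Rightarrow> nat \<Rightarrow> nat" where
  "mate n b t = (if b < n then [2, 1, 2, 3, 1, 1, 3, 2, 1, 2, 3, 3] ! t
     else if t < 5 then [2, 2, 3, 1, 3] ! t else 1)"

abbreviation on_vertex :: "(nat \<Rightarrow> nat \<Rightarrow> nat) \<Rightarrow> nat \<Rightarrow> nat" where
  "on_vertex f v \<equiv> f (v div 12) (v mod 12)"

lemma vx_div [simp]: "t < 12 \<Longrightarrow> vx b t div 12 = b"
  and vx_mod [simp]: "t < 12 \<Longrightarrow> vx b t mod 12 = t"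
  by (auto simp: vx_def)

lemma vx_less:
  "t < 12 \<Longrightarrow> vx b t < 12 * n + 5 \<longleftrightarrow> b < n \<or> b = n \<and> t < 5"
  by (auto simp: vx_def)

lemma less_12_cases:
  fixes t :: nat
  assumes "t < 12"
  obtains "t = 0" | "t = 1" | "t = 2" | "t = 3" | "t = 4" | "t = 5" | "t = 6" | "t = 7" | "t = 8"
    | "t = 9" | "t = 10" | "t = 11"
proof -
  have "t = 0 \<or> t = 1 \<or> t = 2 \<or> t = 3 \<or> t = 4 \<or> t = 5 \<or> t = 6 \<or> t = 7 \<or> t = 8 \<or> t = 9 \<or> t = 10 \<or> t = 11"
    using assms by presburger
  then show ?thesis using that by metis
qed

text \<open>With a numeral for the position within the block, the table lookups can be evaluated by
  simplification.\<close>

lemma vertex_cases: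
  assumes "v < 12 * n + 5"
  obtains b where "b < n" "v = vx b 0"
  | b where "b < n" "v = vx b 1"
  | b where "b < n" "v = vx b 2"
  | b where "b < n" "v = vx b 3"
  | b where "b < n" "v = vx b 4"
  | b where "b < n" "v = vx b 5"
  | b where "b < n" "v = vx b 6"
  | b where "b < n" "v = vx b 7"
  | b where "b < n" "v = vx b 8"
  | b where "b < n" "v = vx b 9"
  | b where "b < n" "v = vx b 10"
  | b where "b < n" "v = vx b 11"
  | "v = vx n 0"
  | "v = vx n 1"
  | "v = vx n 2"
  | "v = vx n 3"
  | "v = vx n 4"
proof -
  have v: "v = vx (v div 12) (v mod 12)" by (simp add: vx_def)
  have t: "v mod 12 < 12" by simp
  consider "v div 12 < n" | "v div 12 = n" "v mod 12 < 5"
    using assms v t vx_less by metis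
  then show ?thesis
  proof cases
    case 1
    from t show ?thesis
      by (cases rule: less_12_cases) (use that(1-12)[OF 1] v in metis)+
  next
    case 2
    from t show ?thesis
      by (cases rule: less_12_cases) (use that(13-17) v 2 in \<open>metis | simp\<close>)+
  qed
qed

section \<open>Both successor functions form hamiltonian cycles\<close>

lemma next1_less:
  assumes "1 \<le> n" "v < 12 * n + 5"
  shows "on_vertex (next1 n) v < 12 * n + 5"
  using assms(2)
  by (cases rule: vertex_cases) (use assms(1) in \<open>auto simp: next1_def vx_less\<close>)

lemma next2_less:
  assumes "1 \<le> n" "v < 12 * n + 5"
  shows "on_vertex (next2 n) v < 12 * n + 5"
  using assms(2)
  by (cases rule: vertex_cases) (use assms(1) in \<open>auto simp: next2_def vx_less\<close>)

lemma ranked_cycle1: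
  assumes n: "1 \<le> n"
  shows "ranked_cycle (12 * n + 5) (on_vertex (next1 n)) (on_vertex (rank1 n))"
proof
  fix v assume v: "v < 12 * n + 5"
  show "on_vertex (next1 n) v < 12 * n + 5" by (rule next1_less[OF n v])
  from v show "on_vertex (rank1 n) v < 12 * n + 5"
    by (cases rule: vertex_cases) (simp_all add: rank1_def)
  from v show "on_vertex (rank1 n) (on_vertex (next1 n) v) =
      (if Suc (on_vertex (rank1 n) v) = 12 * n + 5 then 0 else Suc (on_vertex (rank1 n) v))"
    by (cases rule: vertex_cases) (use n in \<open>simp_all add: rank1_def next1_def\<close>,
        (intro conjI impI; linarith)+)
qed (use n in \<open>simp_all add: rank1_def\<close>)

lemma ranked_cycle2:
  assumes n: "1 \<le> n"
  shows "ranked_cycle (12 * n + 5) (on_vertex (next2 n)) (on_vertex (rank2 n))"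
proof
  fix v assume v: "v < 12 * n + 5"
  show "on_vertex (next2 n) v < 12 * n + 5" by (rule next2_less[OF n v])
  from v show "on_vertex (rank2 n) v < 12 * n + 5"
    by (cases rule: vertex_cases) (simp_all add: rank2_def)
  from v show "on_vertex (rank2 n) (on_vertex (next2 n) v) =
      (if Suc (on_vertex (rank2 n) v) = 12 * n + 5 then 0 else Suc (on_vertex (rank2 n) v))"
    by (cases rule: vertex_cases) (use n in \<open>simp_all add: rank2_def next2_def\<close>,
        (intro conjI impI; linarith)+)
qed (use n in \<open>simp_all add: rank2_def\<close>)

text \<open>A set that is convex in both orders and has two elements contains two consecutive vertices of
  the first cycle. Its closure then has elements on both sides of the middle of the second cycle,
  hence contains \<open>vx 0 1\<close> and \<open>vx 0 11\<close>, the first and the last nonzero vertex of the first cycle.\<close>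

lemma common_convex:
  fixes X :: "nat set"
  assumes n: "1 \<le> n" and X: "X \<subseteq> {..<12 * n + 5}" "0 \<notin> X"
    and c1: "\<And>u w z. u \<in> X \<Longrightarrow> w \<in> X \<Longrightarrow> z < 12 * n + 5 \<Longrightarrow>
      on_vertex (rank1 n) u \<le> on_vertex (rank1 n) z \<Longrightarrow>
      on_vertex (rank1 n) z \<le> on_vertex (rank1 n) w \<Longrightarrow> z \<in> X"
    and c2: "\<And>u w z. u \<in> X \<Longrightarrow> w \<in> X \<Longrightarrow> z < 12 * n + 5 \<Longrightarrow>
      on_vertex (rank2 n) u \<le> on_vertex (rank2 n) z \<Longrightarrow>
      on_vertex (rank2 n) z \<le> on_vertex (rank2 n) w \<Longrightarrow> z \<in> X"
  shows "card X \<le> 1 \<or> X = {0<..<12 * n + 5}"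
proof (rule disjCI)
  interpret ranked_cycle "12 * n + 5" "on_vertex (next1 n)" "on_vertex (rank1 n)"
    by (rule ranked_cycle1[OF n])
  assume ne: "X \<noteq> {0<..<12 * n + 5}"
  have C1: "vx d t \<in> X" if "vx a i \<in> X" "vx b j \<in> X" "i < 12" "j < 12" "t < 12" "d < n \<or> d = n \<and> t < 5"
      "rank1 n a i \<le> rank1 n d t" "rank1 n d t \<le> rank1 n b j" for a b d i j t
    using c1[of "vx a i" "vx b j" "vx d t"] that by (simp add: vx_less)
  have C2: "vx d t \<in> X" if "vx a i \<in> X" "vx b j \<in> X" "i < 12" "j < 12" "t < 12" "d < n \<or> d = n \<and> t < 5"
      "rank2 n a i \<le> rank2 n d t" "rank2 n d t \<le> rank2 n b j" for a b d i j t
    using c2[of "vx a i" "vx b j" "vx d t"] that by (simp add: vx_less)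
  \<comment> \<open>The ranks \<open>6 * n + 1\<close> and \<open>6 * n + 2\<close> on the second
    cycle belong to \<open>vx 0 1\<close> and \<open>vx 0 11\<close>, whose ranks on the first cycle
    are \<open>1\<close> and \<open>12 * n + 4\<close>.\<close>
  have mixed: False if "vx a i \<in> X" "vx b j \<in> X" "i < 12" "j < 12"
    "rank2 n a i \<le> 6 * n + 1" "6 * n + 2 \<le> rank2 n b j" for a b i j
  proof -
    have 0: "vx 0 1 \<in> X" "vx 0 11 \<in> X"
      by (rule C2[OF that(1,2)]; use that n in \<open>simp add: rank2_def\<close>)+
    have "X = {0<..<12 * n + 5}"
    proof (intro equalityI subsetI)
      fix z assume "z \<in> X"
      then show "z \<in> {0<..<12 * n + 5}" using X by (cases "z = 0") auto
    next
      fix z assume z: "z \<in> {0<..<12 * n + 5}"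
      then have "on_vertex (rank1 n) z \<noteq> 0"
        using r_eq_iff[of z 0] r_0 by auto
      moreover have "on_vertex (rank1 n) z < 12 * n + 5"
        using r_less z by auto
      ultimately show "z \<in> X"
        using z by (intro c1[OF 0]) (auto simp: rank1_def)
    qed
    then show False using ne by blast
  qed
  show "card X \<le> 1"
  proof (rule ccontr)
    assume "\<not> card X \<le> 1"
    then obtain x y where xy: "x \<in> X" "y \<in> X" "x \<noteq> y"
      using card_le_Suc0_iff_eq[of X] finite_subset[OF X(1)] by auto
    then have "on_vertex (rank1 n) x \<noteq> on_vertex (rank1 n) y"
      using r_eq_iff[of x y] X by auto
    then obtain u w where u: "u \<in> X" "w \<in> X" "on_vertex (rank1 n) u < on_vertex (rank1 n) w"
      using xy by (metis linorder_neqE_nat)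
    then have "u < 12 * n + 5" "w < 12 * n + 5" using X by auto
    \<comment> \<open>Since \<open>w\<close> has a larger rank than \<open>u\<close>, the step from
      \<open>u\<close> does not wrap around, and its end lies between \<open>u\<close> and
      \<open>w\<close>.\<close>
    then have s: "on_vertex (next1 n) u \<in> X"
      using u r_s[of u] r_less[of w] s_less[of u] by (intro c1[OF u(1,2)]) auto
    from \<open>u < 12 * n + 5\<close> show False
    \<comment> \<open>In each case \<open>m\<close> is the consecutive pair; where needed,
      \<open>k0\<close> is added by convexity on the second cycle and then \<open>k1\<close> by
      convexity on the first, until \<open>mixed\<close> applies.\<close>
    proof (cases rule: vertex_cases)
        case (1 b)
        have m: "vx b 0 \<in> X" "vx b 1 \<in> X"
          using s u(1) 1 by (simp_all add: next1_def)
        have k0: "vx b 10 \<in> X"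
          by (rule C2[OF m(1) m(2)]) (use 1(1) in \<open>simp_all add: rank2_def\<close>)
        have k1: "vx b 2 \<in> X"
          by (rule C1[OF m(1) k0]) (use 1(1) in \<open>simp_all add: rank1_def\<close>)
        show False
          by (rule mixed[OF m(1) k1]) (use 1(1) in \<open>simp_all add: rank2_def\<close>)
      next
        case (2 b)
        have m: "vx b 1 \<in> X" "vx b 2 \<in> X"
          using s u(1) 2 by (simp_all add: next1_def numeral_2_eq_2)
        show False
          by (rule mixed[OF m(1) m(2)]) (use 2(1) in \<open>simp_all add: rank2_def\<close>)
      next
        case (3 b)
        have m: "vx b 2 \<in> X" "vx b 3 \<in> X"
          using s u(1) 3 by (simp_all add: next1_def)
        have k0: "vx b 7 \<in> X"
          by (rule C2[OF m(1) m(2)]) (use 3(1) in \<open>simp_all add: rank2_def\<close>)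
        have k1: "vx b 5 \<in> X"
          by (rule C1[OF m(1) k0]) (use 3(1) in \<open>simp_all add: rank1_def\<close>)
        show False
          by (rule mixed[OF k1 m(1)]) (use 3(1) in \<open>simp_all add: rank2_def\<close>)
      next
        case (4 b)
        have m: "vx b 3 \<in> X" "vx b 4 \<in> X"
          using s u(1) 4 by (simp_all add: next1_def)
        have k0: "vx b 8 \<in> X"
          by (rule C2[OF m(1) m(2)]) (use 4(1) in \<open>simp_all add: rank2_def\<close>)
        have k1: "vx b 5 \<in> X"
          by (rule C1[OF m(1) k0]) (use 4(1) in \<open>simp_all add: rank1_def\<close>)
        show False
          by (rule mixed[OF k1 m(1)]) (use 4(1) in \<open>simp_all add: rank2_def\<close>)
      next
        case (5 b)
        have m: "vx b 4 \<in> X" "vx b 5 \<in> X"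
          using s u(1) 5 by (simp_all add: next1_def)
        show False
          by (rule mixed[OF m(2) m(1)]) (use 5(1) in \<open>simp_all add: rank2_def\<close>)
      next
        case (6 b)
        have m: "vx b 5 \<in> X" "vx b 6 \<in> X"
          using s u(1) 6 by (simp_all add: next1_def)
        have k0: "vx b 9 \<in> X"
          by (rule C2[OF m(2) m(1)]) (use 6(1) in \<open>simp_all add: rank2_def\<close>)
        have k1: "vx b 7 \<in> X"
          by (rule C1[OF m(1) k0]) (use 6(1) in \<open>simp_all add: rank1_def\<close>)
        show False
          by (rule mixed[OF m(1) k1]) (use 6(1) in \<open>simp_all add: rank2_def\<close>)
      next
        case (7 b)
        have m: "vx b 6 \<in> X" "vx (b + 1) 0 \<in> X"
          using s u(1) 7 by (simp_all add: next1_def)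
        have k0: "vx b 9 \<in> X"
          by (rule C2[OF m(1) m(2)]) (use 7(1) in \<open>simp_all add: rank2_def\<close>)
        have k1: "vx b 7 \<in> X"
          by (rule C1[OF m(1) k0]) (use 7(1) in \<open>simp_all add: rank1_def\<close>)
        show False
          by (rule mixed[OF m(1) k1]) (use 7(1) in \<open>simp_all add: rank2_def\<close>)
      next
        case (8 b)
        have m: "vx b 7 \<in> X" "vx b 8 \<in> X"
          using s u(1) 8 by (simp_all add: next1_def)
        have k0: "vx b 3 \<in> X"
          by (rule C2[OF m(1) m(2)]) (use 8(1) in \<open>simp_all add: rank2_def\<close>)
        have k1: "vx b 5 \<in> X"
          by (rule C1[OF k0 m(1)]) (use 8(1) in \<open>simp_all add: rank1_def\<close>)
        show False
          by (rule mixed[OF k1 m(1)]) (use 8(1) in \<open>simp_all add: rank2_def\<close>)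
      next
        case (9 b)
        have m: "vx b 8 \<in> X" "vx b 9 \<in> X"
          using s u(1) 9 by (simp_all add: next1_def)
        show False
          by (rule mixed[OF m(2) m(1)]) (use 9(1) in \<open>simp_all add: rank2_def\<close>)
      next
        case (10 b)
        have m: "vx b 9 \<in> X" "vx b 10 \<in> X"
          using s u(1) 10 by (simp_all add: next1_def)
        have k0: "vx b 6 \<in> X"
          by (rule C2[OF m(2) m(1)]) (use 10(1) in \<open>simp_all add: rank2_def\<close>)
        have k1: "vx b 7 \<in> X"
          by (rule C1[OF k0 m(1)]) (use 10(1) in \<open>simp_all add: rank1_def\<close>)
        show False
          by (rule mixed[OF k0 k1]) (use 10(1) in \<open>simp_all add: rank2_def\<close>)
      next
        case (11 b)
        have m: "vx b 10 \<in> X" "vx b 11 \<in> X"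
          using s u(1) 11 by (simp_all add: next1_def)
        show False
          by (rule mixed[OF m(1) m(2)]) (use 11(1) in \<open>simp_all add: rank2_def\<close>)
      next
        case (12 b)
        \<comment> \<open>The successor of \<open>vx 0 11\<close> is 0, which is not in
          \<open>X\<close>.\<close>
        have "b \<noteq> 0"
        proof
          assume "b = 0"
          then show False using s 12(2) n X by (simp add: next1_def vx_def)
        qed
        then obtain a where b: "b = Suc a" by (cases b) auto
        have m: "vx b 11 \<in> X" "vx a 7 \<in> X"
          using s u(1) 12 b by (simp_all add: next1_def)
        have k0: "vx a 3 \<in> X"
          by (rule C2[OF m(2) m(1)]) (use 12(1) b in \<open>simp_all add: rank2_def\<close>)
        have k1: "vx a 5 \<in> X"
          by (rule C1[OF k0 m(2)]) (use 12(1) b in \<open>simp_all add: rank1_def\<close>)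
        show False
          by (rule mixed[OF k1 m(2)]) (use 12(1) b in \<open>simp_all add: rank2_def\<close>)
      next
        case 13
        have m: "vx n 0 \<in> X" "vx n 1 \<in> X"
          using s u(1) 13 n by (simp_all add: next1_def)
        show False
          by (rule mixed[OF m(1) m(2)]) (use n in \<open>simp_all add: rank2_def\<close>)
      next
        case 14
        have m: "vx n 1 \<in> X" "vx n 2 \<in> X"
          using s u(1) 14 n by (simp_all add: next1_def numeral_2_eq_2)
        show False
          by (rule mixed[OF m(2) m(1)]) (use n in \<open>simp_all add: rank2_def\<close>)
      next
        case 15
        have m: "vx n 2 \<in> X" "vx n 3 \<in> X"
          using s u(1) 15 n by (simp_all add: next1_def)
        show False
          by (rule mixed[OF m(1) m(2)]) (use n in \<open>simp_all add: rank2_def\<close>)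
      next
        case 16
        have m: "vx n 3 \<in> X" "vx n 4 \<in> X"
          using s u(1) 16 n by (simp_all add: next1_def)
        have k0: "vx n 1 \<in> X"
          by (rule C2[OF m(2) m(1)]) (use n in \<open>simp_all add: rank2_def\<close>)
        have k1: "vx n 2 \<in> X"
          by (rule C1[OF k0 m(1)]) (use n in \<open>simp_all add: rank1_def\<close>)
        show False
          by (rule mixed[OF k1 m(1)]) (use n in \<open>simp_all add: rank2_def\<close>)
      next
        case 17
        have m: "vx n 4 \<in> X" "vx (n - 1) 7 \<in> X"
          using s u(1) 17 n by (simp_all add: next1_def)
        have k0: "vx (n - 1) 3 \<in> X"
          by (rule C2[OF m(2) m(1)]) (use n in \<open>simp_all add: rank2_def\<close>)
        have k1: "vx (n - 1) 5 \<in> X"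
          by (rule C1[OF k0 m(2)]) (use n in \<open>simp_all add: rank1_def\<close>)
        show False
          by (rule mixed[OF k1 m(2)]) (use n in \<open>simp_all add: rank2_def\<close>)
    qed
  qed
qed


section \<open>Propagating the label relation from the tail to block 0\<close>

lemma no_labelling:
  fixes c :: "nat \<Rightarrow> 'c"
  assumes n: "1 \<le> n"
    and c1: "\<And>v. v < 12 * n + 5 \<Longrightarrow> c (half (on_vertex (next1 n) v) 1) = c (half v 0)"
    and c2: "\<And>v. v < 12 * n + 5 \<Longrightarrow> c (half (on_vertex (next2 n) v) 3) = c (half v 2)"
    and m: "\<And>v. v < 12 * n + 5 \<Longrightarrow> on_vertex (mate n) v = 1 \<Longrightarrow>
      swap (c (half v 0)) (c (half v 1)) (c (half v 2)) (c (half v 3))"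
      "\<And>v. v < 12 * n + 5 \<Longrightarrow> on_vertex (mate n) v = 2 \<Longrightarrow>
      swap (c (half v 1)) (c (half v 3)) (c (half v 0)) (c (half v 2))"
      "\<And>v. v < 12 * n + 5 \<Longrightarrow> on_vertex (mate n) v = 3 \<Longrightarrow>
      swap (c (half v 0)) (c (half v 3)) (c (half v 1)) (c (half v 2))"
  shows False
proof -
  define l where "l k b t = c (half (vx b t) k)" for k b t
  have C1: "l 0 b t = c (half (next1 n b t) 1)"
    and C2: "l 2 b t = c (half (next2 n b t) 3)"
    if "b < n \<and> t < 12 \<or> b = n \<and> t < 5" for b t
    using c1[of "vx b t"] c2[of "vx b t"] vx_less[of t b n] that by (auto simp: l_def)
  have l: "c (half (vx b t) k) = l k b t" for b t k by (simp add: l_def)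
  have M: "swap (l 0 b t) (l 1 b t) (l 2 b t) (l 3 b t)" if "mate n b t = 1"
      "b < n \<and> t < 12 \<or> b = n \<and> t < 5" for b t
    using m(1)[of "vx b t"] vx_less[of t b n] that by (auto simp: l_def)
  have M2: "swap (l 1 b t) (l 3 b t) (l 0 b t) (l 2 b t)" if "mate n b t = 2"
      "b < n \<and> t < 12 \<or> b = n \<and> t < 5" for b t
    using m(2)[of "vx b t"] vx_less[of t b n] that by (auto simp: l_def)
  have M3: "swap (l 0 b t) (l 3 b t) (l 1 b t) (l 2 b t)" if "mate n b t = 3"
      "b < n \<and> t < 12 \<or> b = n \<and> t < 5" for b t
    using m(3)[of "vx b t"] vx_less[of t b n] that by (auto simp: l_def)
  \<comment> \<open>The lower interface of a block sits at its vertices 0, 11, 1, 4, that of the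
    tail at 0, 4, 2, 3; with \<open>w\<close>, \<open>x\<close>, \<open>y\<close> one statement
    \<open>Q\<close> covers both.\<close>
  define w where "w b = (if b < n then 11 else 4 :: nat)" for b
  define y where "y b = (if b < n then 4 else 3 :: nat)" for b
  define x where "x b = (if b < n then 1 else 2 :: nat)" for b
  define Q where "Q b \<longleftrightarrow> linked {l 1 b 0, l 3 b 0} {l 3 b (w b), l 0 b (w b)} (l 2 b (x b)) (l 2 b (y b))" for b
  have Qn: "Q n"
  proof -
    have C: "l 1 n 1 = l 0 n 0" "l 1 n 2 = l 0 n 1" "l 1 n 3 = l 0 n 2" "l 1 n 4 = l 0 n 3"
      "l 3 n 2 = l 2 n 0" "l 3 n 3 = l 2 n 1" "l 3 n 1 = l 2 n 4"
      using C1[of n 0] C1[of n 1] C1[of n 2] C1[of n 3] C2[of n 0] C2[of n 1] C2[of n 4]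
      by (simp_all add: next1_def next2_def l numeral_2_eq_2[symmetric])
    show ?thesis
      unfolding Q_def w_def x_def y_def
      using linked_tail[of "l 1 n 0" "l 3 n 0" "l 0 n 0" "l 2 n 0" "l 2 n 4" "l 0 n 1" "l 2 n 1" "l 0 n 2"
        "l 2 n 2" "l 0 n 3" "l 2 n 3" "l 0 n 4" "l 3 n 4"]
      using M2[of n 0] M2[of n 1] M3[of n 2] M[of n 3] M3[of n 4] C
      by (simp add: mate_def)
  qed
  have Qb: "Q b" if "b < n" "Q (Suc b)" for b
  proof -
    have C: "l 1 b 1 = l 0 b 0" "l 1 b 2 = l 0 b 1" "l 1 b 3 = l 0 b 2" "l 1 b 4 = l 0 b 3"
      "l 1 b 5 = l 0 b 4" "l 1 b 6 = l 0 b 5" "l 1 b 8 = l 0 b 7" "l 1 b 9 = l 0 b 8"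
      "l 1 b 10 = l 0 b 9" "l 1 b 11 = l 0 b 10" "l 1 (Suc b) 0 = l 0 b 6"
      "l 3 b 10 = l 2 b 0" "l 3 b 6 = l 2 b 10" "l 3 b 9 = l 2 b 6" "l 3 b 5 = l 2 b 9"
      "l 3 b 2 = l 2 b 11" "l 3 b 7 = l 2 b 2" "l 3 b 3 = l 2 b 7" "l 3 b 8 = l 2 b 3"
      "l 3 (Suc b) 0 = l 2 b 5" "l 3 (Suc b) (w (Suc b)) = l 2 b 8"
      using C1[of b 0] C1[of b 1] C1[of b 2] C1[of b 3] C1[of b 4] C1[of b 5] C1[of b 6] C1[of b 7]
        C1[of b 8] C1[of b 9] C1[of b 10] C2[of b 0] C2[of b 10] C2[of b 6] C2[of b 9] C2[of b 11] C2[of b 2]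
        C2[of b 7] C2[of b 3] C2[of b 5] C2[of b 8] that(1)
      by (simp_all add: next1_def next2_def l numeral_2_eq_2[symmetric] w_def) (cases "Suc b = n"; simp)
    \<comment> \<open>These three edges run from the next block or the tail down into block
      \<open>b\<close>.\<close>
    have D: "l 0 (Suc b) (w (Suc b)) = l 1 b 7" "l 2 (Suc b) (x (Suc b)) = l 3 b 1"
      "l 2 (Suc b) (y (Suc b)) = l 3 b 4"
      using C1[of "Suc b" "w (Suc b)"] C2[of "Suc b" "x (Suc b)"] C2[of "Suc b" "y (Suc b)"] that(1)
      by (cases "Suc b = n"; force simp: next1_def next2_def l w_def x_def y_def)+
    \<comment> \<open>Both pairs are transitions, at vertex 0 and at vertex
      \<open>w (Suc b)\<close>.\<close>
    have N: "l 1 (Suc b) 0 \<noteq> l 3 (Suc b) 0" "l 3 (Suc b) (w (Suc b)) \<noteq> l 0 (Suc b) (w (Suc b))"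
      using M2[of "Suc b" 0] M3[of "Suc b" "w (Suc b)"] that(1)
      by (cases "Suc b = n"; force simp: mate_def w_def swap_def)+
    show ?thesis
      using linked_block[of "l 1 b 0" "l 3 b 0" "l 0 b 0" "l 2 b 0" "l 0 b 1" "l 2 b 1" "l 3 b 1"
        "l 2 b 11" "l 0 b 2" "l 2 b 2" "l 0 b 3" "l 2 b 7" "l 2 b 3" "l 0 b 4" "l 2 b 4" "l 3 b 4"
        "l 0 b 5" "l 2 b 5" "l 2 b 9" "l 0 b 6" "l 2 b 10" "l 2 b 6" "l 1 b 7" "l 0 b 7" "l 0 b 8" "l 2 b 8"
        "l 0 b 9" "l 0 b 10" "l 0 b 11" "l 3 b 11"]
      using M2[of b 0] M[of b 1] M2[of b 2] M3[of b 3] M[of b 4] M[of b 5] M3[of b 6] M2[of b 7]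
        M[of b 8] M2[of b 9] M3[of b 10] M3[of b 11] that N
      unfolding Q_def D C by (simp add: mate_def w_def x_def y_def C)
  qed
  \<comment> \<open>Induction downwards, with \<open>k\<close> counting the blocks passed since the
    tail.\<close>
  have "Q (n - k)" if "k \<le> n" for k
    using that
  proof (induct k)
    case (Suc k)
    then show ?case using Qb[of "n - Suc k"] by (simp add: Suc_diff_Suc)
  qed (simp add: Qn)
  from this[of n] have "Q 0" by simp
  moreover have "l 1 0 0 = l 0 0 11" "l 3 0 0 = l 2 0 4" "l 3 0 11 = l 2 0 1"
    using C1[of 0 11] C2[of 0 4] C2[of 0 1] n by (auto simp: next1_def next2_def l)
  moreover have "l 1 0 0 \<noteq> l 3 0 0" "l 0 0 11 \<noteq> l 3 0 11"
    using M2[of 0 0] M3[of 0 11] n by (auto simp: mate_def swap_def)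
  \<comment> \<open>Write \<open>x\<close> and \<open>y\<close> for the last two labels in
    \<open>Q 0\<close>. The closing edges turn the two pairs into \<open>{p, y}\<close> and
    \<open>{x, p}\<close> with \<open>p\<close> distinct from \<open>x\<close> and \<open>y\<close>.
    If \<open>x\<close> and \<open>y\<close> differ, \<open>x\<close> must lie in
    \<open>{p, y}\<close>; if they agree, \<open>y\<close> must not. Both are false.\<close>
  ultimately show False
    using n by (auto simp: Q_def linked_def w_def x_def y_def doubleton_eq_iff)
qed

lemma mate_range: "on_vertex (mate n) v \<in> {1, 2, 3}"
proof -
  have "v mod 12 < 12" by simp
  then show ?thesis
    by (cases rule: less_12_cases) (simp_all add: mate_def)
qed

theorem corollary2p27:
  fixes n :: nat
  assumes "n \<ge> 1"
  shows "\<exists>(G :: (nat, nat) pre_digraph) arev T.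
           multigraph G arev \<and>
           card (verts G) = 5 + 12 * n \<and>
           essentially_edge_connected 6 G arev \<and>
           regular 4 G \<and>
           transition_system G T \<and>
           \<not> ((\<nexists>D. compatible_cycle_decomposition G arev T D) \<longleftrightarrow>
               bad_loop G arev T \<or> bad_K5 G arev T)"
proof -
  interpret two_cycles "12 * n + 5" "on_vertex (next1 n)" "on_vertex (rank1 n)"
    "on_vertex (next2 n)" "on_vertex (rank2 n)" "on_vertex (mate n)"
    by (intro two_cycles.intro two_cycles_axioms.intro ranked_cycle1 ranked_cycle2 assms mate_range)
      (erule (1) common_convex[OF assms], blast+)
  have card: "card (verts G) = 5 + 12 * n" by simp
  have "\<nexists>D. compatible_cycle_decomposition G arev T D"
  proof
    assume "\<exists>D. compatible_cycle_decomposition G arev T D"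
    then obtain D where "compatible_cycle_decomposition G arev T D" by blast
    then obtain c :: "nat \<Rightarrow> (nat, nat) pre_digraph" where c:
      "\<And>v. v < 12 * n + 5 \<Longrightarrow> c (half (on_vertex (next1 n) v) 1) = c (half v 0)"
      "\<And>v. v < 12 * n + 5 \<Longrightarrow> c (half (on_vertex (next2 n) v) 3) = c (half v 2)"
      "\<And>v h i j k. v < 12 * n + 5 \<Longrightarrow> T v = {{h, i}, {j, k}} \<Longrightarrow>
        {h, i, j, k} = {half v 0, half v 1, half v 2, half v 3} \<Longrightarrow> distinct [h, i, j, k] \<Longrightarrow>
        c h \<noteq> c i \<and> c j \<noteq> c k \<and> {c h, c i} = {c j, c k}"
      by (rule labelling) (rule that)
    have sw: "swap (c h) (c i) (c j) (c k)"
      if "v < 12 * n + 5" "T v = {{h, i}, {j, k}}"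
        "{h, i, j, k} = {half v 0, half v 1, half v 2, half v 3}" "distinct [h, i, j, k]"
      for v h i j k
      using c(3)[OF that] by (auto simp: swap_def doubleton_eq_iff)
    show False
    proof (rule no_labelling[of n c])
      fix v assume v: "v < 12 * n + 5"
      show "swap (c (half v 0)) (c (half v 1)) (c (half v 2)) (c (half v 3))"
        if "on_vertex (mate n) v = 1"
        by (rule sw[OF v]) (use that in \<open>auto simp: T_def\<close>)
      show "swap (c (half v 1)) (c (half v 3)) (c (half v 0)) (c (half v 2))"
        if "on_vertex (mate n) v = 2"
        by (rule sw[OF v]) (use that in \<open>auto simp: T_def\<close>)
      show "swap (c (half v 0)) (c (half v 3)) (c (half v 1)) (c (half v 2))"
        if "on_vertex (mate n) v = 3"
        by (rule sw[OF v]) (use that in \<open>auto simp: T_def\<close>)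
    qed (use assms c(1,2) in blast)+
  qed
  moreover have "\<not> bad_loop G arev T"
  proof
    assume "bad_loop G arev T"
    then obtain v where "verts G = {v}" unfolding bad_loop_def by blast
    then show False using card by (simp del: G_simps)
  qed
  \<comment> \<open>As \<open>n\<close> is at least 1, the graph has at least 17 vertices.\<close>
  moreover have "\<not> bad_K5 G arev T"
    using card assms by (auto simp: bad_K5_def complete_digraph_def)
  ultimately show ?thesis
    using multigraph_axioms card essentially_6_edge_connected regular_G transition_system_T
    by blast
qed

end
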